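(* Let $0<\alpha_0<\alpha_1=\alpha_2<\alpha_3$. The geodesic flow on the three-dimensional ellipsoid $\{x\in\mathbb{R}^4 : \sum_{i=0}^3 x_i^2/\alpha_i=1\}$ with equal middle semi-axes, regarded as the Hamiltonian system with Hamiltonian $H$ on the 6-dimensional symplectic manifold $M$ with the Dirac bracket (see context), is Liouville integrable. Constants of motion (pairwise in involution, and functionally independent almost everywhere on $M$) are the energy $$H=\tfrac12\left(y_0^2+y_1^2+y_2^2+y_3^2\right),$$ the angular momentum $$J=x_1y_2-x_2y_1,$$ and the third integral $$G = y_1^2 + y_2^2 + \frac{(x_0y_1 - x_1y_0)^2}{\alpha_1 - \alpha_0} + \frac{(x_0y_2 - x_2y_0)^2}{\alpha_1 - \alpha_0} + \frac{(x_1y_3 - x_3y_1)^2}{\alpha_1 - \alpha_3} + \frac{(x_2y_3 - x_3y_2)^2}{\alpha_1 - \alpha_3}.$$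
   Context: Coordinates on $\mathbb{R}^8$ are $(x,y)=(x_0,x_1,x_2,x_3,y_0,y_1,y_2,y_3)$. Put $C_1=\sum_{i=0}^3 x_i^2/\alpha_i-1$, $C_2=\sum_{i=0}^3 x_iy_i/\alpha_i$, $D=\sum_{i=0}^3 x_i^2/\alpha_i^2$. The Dirac bracket (a Poisson bracket where $D\neq0$, with Casimirs $C_1,C_2$) is $$\{x_i,x_j\}=0,\qquad \{x_i,y_j\}=\delta_{ij}-\frac{x_ix_j}{D\alpha_i\alpha_j},\qquad \{y_i,y_j\}=-\frac{x_iy_j-x_jy_i}{D\alpha_i\alpha_j}.$$ The phase space is the symplectic leaf $M=\{C_1=C_2=0\}\subset\mathbb{R}^8$, which is 6-dimensional and is the (co)tangent bundle of the ellipsoid. The geodesic flow is $\dot x_i=\{x_i,H\}$, $\dot y_i=\{y_i,H\}$ on $M$. *)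

theory Defs
  imports "HOL-Analysis.Analysis"
begin

text \<open>
  Points of $\mathbb{R}^8$ are pairs $(x, y)$ of vectors in \<^typ>\<open>real^4\<close>. The index type
  \<^typ>\<open>4\<close> has exactly the elements 0, 1, 2, 3.
\<close>

type_synonym point = "(real^4) \<times> (real^4)"

definition C1 :: "(4 \<Rightarrow> real) \<Rightarrow> point \<Rightarrow> real" where
  "C1 \<alpha> = (\<lambda>(x, y). (\<Sum>i\<in>UNIV. (x$i)\<^sup>2 / \<alpha> i) - 1)"

definition C2 :: "(4 \<Rightarrow> real) \<Rightarrow> point \<Rightarrow> real" where
  "C2 \<alpha> = (\<lambda>(x, y). \<Sum>i\<in>UNIV. x$i * y$i / \<alpha> i)"

definition D :: "(4 \<Rightarrow> real) \<Rightarrow> point \<Rightarrow> real" where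
  "D \<alpha> = (\<lambda>(x, y). \<Sum>i\<in>UNIV. (x$i)\<^sup>2 / (\<alpha> i)\<^sup>2)"

definition phase_space :: "(4 \<Rightarrow> real) \<Rightarrow> point set" where
  "phase_space \<alpha> = {p. C1 \<alpha> p = 0 \<and> C2 \<alpha> p = 0}"

definition coord_x :: "4 \<Rightarrow> point \<Rightarrow> real" where
  "coord_x i p = fst p $ i"

definition coord_y :: "4 \<Rightarrow> point \<Rightarrow> real" where
  "coord_y i p = snd p $ i"

definition partial_x :: "4 \<Rightarrow> (point \<Rightarrow> real) \<Rightarrow> point \<Rightarrow> real" where
  "partial_x i f p = frechet_derivative f (at p) (axis i 1, 0)"

definition partial_y :: "4 \<Rightarrow> (point \<Rightarrow> real) \<Rightarrow> point \<Rightarrow> real" where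
  "partial_y i f p = frechet_derivative f (at p) (0, axis i 1)"

definition tensor_xy :: "(4 \<Rightarrow> real) \<Rightarrow> point \<Rightarrow> 4 \<Rightarrow> 4 \<Rightarrow> real" where
  "tensor_xy \<alpha> p i j = (case p of (x, y) \<Rightarrow>
     (if i = j then 1 else 0) - x$i * x$j / (D \<alpha> p * \<alpha> i * \<alpha> j))"

definition tensor_yy :: "(4 \<Rightarrow> real) \<Rightarrow> point \<Rightarrow> 4 \<Rightarrow> 4 \<Rightarrow> real" where
  "tensor_yy \<alpha> p i j = (case p of (x, y) \<Rightarrow>
     - (x$i * y$j - x$j * y$i) / (D \<alpha> p * \<alpha> i * \<alpha> j))"

text \<open>
  The biderivation extending the brackets of the coordinate functions; see the three lemmas
  below. Where $D = 0$ (never on the phase space) the value is meaningless.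
\<close>

definition dirac_bracket ::
    "(4 \<Rightarrow> real) \<Rightarrow> (point \<Rightarrow> real) \<Rightarrow> (point \<Rightarrow> real) \<Rightarrow> point \<Rightarrow> real" where
  "dirac_bracket \<alpha> f g p =
     (\<Sum>i\<in>UNIV. \<Sum>j\<in>UNIV.
        tensor_xy \<alpha> p i j *
          (partial_x i f p * partial_y j g p - partial_y j f p * partial_x i g p)
      + tensor_yy \<alpha> p i j * partial_y i f p * partial_y j g p)"

lemma frechet_derivative_coord_x: "frechet_derivative (coord_x i) (at p) = (\<lambda>v. fst v $ i)"
proof -
  have "(coord_x i has_derivative (\<lambda>v. fst v $ i)) (at p)"
    unfolding coord_x_def
    by (intro bounded_linear_imp_has_derivative
        bounded_linear_compose[OF bounded_linear_vec_nth bounded_linear_fst])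
  then show ?thesis
    by (metis frechet_derivative_at)
qed

lemma frechet_derivative_coord_y: "frechet_derivative (coord_y i) (at p) = (\<lambda>v. snd v $ i)"
proof -
  have "(coord_y i has_derivative (\<lambda>v. snd v $ i)) (at p)"
    unfolding coord_y_def
    by (intro bounded_linear_imp_has_derivative
        bounded_linear_compose[OF bounded_linear_vec_nth bounded_linear_snd])
  then show ?thesis
    by (metis frechet_derivative_at)
qed

lemma partial_coord:
  "partial_x i (coord_x k) p = (if i = k then 1 else 0)"
  "partial_y i (coord_x k) p = 0"
  "partial_x i (coord_y k) p = 0"
  "partial_y i (coord_y k) p = (if i = k then 1 else 0)"
  by (auto simp: partial_x_def partial_y_def frechet_derivative_coord_x
      frechet_derivative_coord_y axis_def)

lemma dirac_bracket_x_x: "dirac_bracket \<alpha> (coord_x i) (coord_x j) p = 0"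
  by (simp add: dirac_bracket_def partial_coord)

lemma dirac_bracket_x_y: "dirac_bracket \<alpha> (coord_x i) (coord_y j) p = tensor_xy \<alpha> p i j"
  by (simp add: dirac_bracket_def partial_coord if_distrib[of "\<lambda>t. _ * t"]
      if_distrib[of "\<lambda>t. t * _"] sum.If_cases cong: if_cong)

lemma dirac_bracket_y_y: "dirac_bracket \<alpha> (coord_y i) (coord_y j) p = tensor_yy \<alpha> p i j"
  by (simp add: dirac_bracket_def partial_coord if_distrib[of "\<lambda>t. _ * t"]
      if_distrib[of "\<lambda>t. t * _"] sum.If_cases cong: if_cong)

definition hamiltonian_vector_field ::
    "(4 \<Rightarrow> real) \<Rightarrow> (point \<Rightarrow> real) \<Rightarrow> point \<Rightarrow> point" where
  "hamiltonian_vector_field \<alpha> F p =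
     (\<chi> i. dirac_bracket \<alpha> (coord_x i) F p, \<chi> i. dirac_bracket \<alpha> (coord_y i) F p)"

text \<open>$C^\infty$, for open \<open>S\<close>: every iterated directional derivative is differentiable on \<open>S\<close>.\<close>

coinductive smooth_on ::
    "'a::euclidean_space set \<Rightarrow> ('a \<Rightarrow> 'b::real_normed_vector) \<Rightarrow> bool" for S where
  "(\<And>p. p \<in> S \<Longrightarrow> f differentiable (at p)) \<Longrightarrow>
   (\<And>v. smooth_on S (\<lambda>p. frechet_derivative f (at p) v)) \<Longrightarrow> smooth_on S f"

text \<open>
  The differentials of $C_1$ and $C_2$ are linearly independent at every point of the phase
  space, so its tangent space is their common kernel.
\<close>

definition tangent_space :: "(4 \<Rightarrow> real) \<Rightarrow> point \<Rightarrow> point set" where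
  "tangent_space \<alpha> p = {v. frechet_derivative (C1 \<alpha>) (at p) v = 0 \<and>
                           frechet_derivative (C2 \<alpha>) (at p) v = 0}"

definition local_parametrization ::
    "(4 \<Rightarrow> real) \<Rightarrow> (real^6) set \<Rightarrow> (real^6 \<Rightarrow> point) \<Rightarrow> bool" where
  "local_parametrization \<alpha> U \<phi> \<longleftrightarrow>
     open U \<and> smooth_on U \<phi> \<and>
     openin (top_of_set (phase_space \<alpha>)) (\<phi> ` U) \<and>
     (\<exists>\<psi>. homeomorphism U (\<phi> ` U) \<phi> \<psi>) \<and>
     (\<forall>u\<in>U. inj (frechet_derivative \<phi> (at u)))"

text \<open>Measure zero in the 6-dimensional manifold: Lebesgue-null in every chart.\<close>

definition null_in_phase_space :: "(4 \<Rightarrow> real) \<Rightarrow> point set \<Rightarrow> bool" where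
  "null_in_phase_space \<alpha> N \<longleftrightarrow>
     (\<forall>U \<phi>. local_parametrization \<alpha> U \<phi> \<longrightarrow> negligible {u \<in> U. \<phi> u \<in> N})"

text \<open>Linear independence of the differentials restricted to the tangent space.\<close>

definition independent_at :: "(4 \<Rightarrow> real) \<Rightarrow> (point \<Rightarrow> real) list \<Rightarrow> point \<Rightarrow> bool" where
  "independent_at \<alpha> Fs p \<longleftrightarrow>
     (\<forall>c :: nat \<Rightarrow> real.
        (\<forall>v\<in>tangent_space \<alpha> p.
           (\<Sum>k<length Fs. c k * frechet_derivative (Fs ! k) (at p) v) = 0) \<longrightarrow>
        (\<forall>k<length Fs. c k = 0))"

text \<open>
  The second conjunct says that the bracket is nondegenerate (symplectic) on the phase space,
  the third that the number of integrals is half the dimension.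
\<close>

definition liouville_integrable ::
    "(4 \<Rightarrow> real) \<Rightarrow> (point \<Rightarrow> real) \<Rightarrow> (point \<Rightarrow> real) list \<Rightarrow> bool" where
  "liouville_integrable \<alpha> H Fs \<longleftrightarrow>
     H \<in> set Fs \<and>
     (\<forall>p\<in>phase_space \<alpha>.
        {hamiltonian_vector_field \<alpha> F p |F. smooth_on UNIV F} = tangent_space \<alpha> p) \<and>
     (\<forall>p\<in>phase_space \<alpha>. dim (tangent_space \<alpha> p) = 2 * length Fs) \<and>
     (\<forall>F\<in>set Fs. smooth_on UNIV F) \<and>
     (\<forall>F\<in>set Fs. \<forall>F'\<in>set Fs. \<forall>p\<in>phase_space \<alpha>. dirac_bracket \<alpha> F F' p = 0) \<and>
     null_in_phase_space \<alpha> {p \<in> phase_space \<alpha>. \<not> independent_at \<alpha> Fs p}"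

definition flow_line ::
    "(4 \<Rightarrow> real) \<Rightarrow> (point \<Rightarrow> real) \<Rightarrow> real set \<Rightarrow> (real \<Rightarrow> point) \<Rightarrow> bool" where
  "flow_line \<alpha> H I \<gamma> \<longleftrightarrow>
     open I \<and> connected I \<and>
     (\<forall>t\<in>I. \<gamma> t \<in> phase_space \<alpha> \<and>
        (\<gamma> has_vector_derivative hamiltonian_vector_field \<alpha> H (\<gamma> t)) (at t))"

definition constant_of_motion ::
    "(4 \<Rightarrow> real) \<Rightarrow> (point \<Rightarrow> real) \<Rightarrow> (point \<Rightarrow> real) \<Rightarrow> bool" where
  "constant_of_motion \<alpha> H F \<longleftrightarrow>
     (\<forall>I \<gamma>. flow_line \<alpha> H I \<gamma> \<longrightarrow> (\<forall>s\<in>I. \<forall>t\<in>I. F (\<gamma> s) = F (\<gamma> t)))"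

definition energy :: "point \<Rightarrow> real" where
  "energy = (\<lambda>(x, y). 1/2 * ((y$0)\<^sup>2 + (y$1)\<^sup>2 + (y$2)\<^sup>2 + (y$3)\<^sup>2))"

definition angular_momentum :: "point \<Rightarrow> real" where
  "angular_momentum = (\<lambda>(x, y). x$1 * y$2 - x$2 * y$1)"

definition third_integral :: "(4 \<Rightarrow> real) \<Rightarrow> point \<Rightarrow> real" where
  "third_integral \<alpha> = (\<lambda>(x, y).
     (y$1)\<^sup>2 + (y$2)\<^sup>2
     + (x$0 * y$1 - x$1 * y$0)\<^sup>2 / (\<alpha> 1 - \<alpha> 0)
     + (x$0 * y$2 - x$2 * y$0)\<^sup>2 / (\<alpha> 1 - \<alpha> 0)
     + (x$1 * y$3 - x$3 * y$1)\<^sup>2 / (\<alpha> 1 - \<alpha> 3)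
     + (x$2 * y$3 - x$3 * y$2)\<^sup>2 / (\<alpha> 1 - \<alpha> 3))"

end

theory Submission
  imports Defs
begin

text \<open>
  The vertical gradients $\partial F/\partial y$ of the three integrals are orthogonal to the conormal
  $n = (x_i/\alpha_i)_i$ of the ellipsoid along $M$, so there all correction terms of the Dirac bracket
  drop out and involution reduces to the canonical bracket.

  Functional independence almost everywhere rests on one remark: in a 6-dimensional chart the
  points of a level set $h = 0$ with $dh \neq 0$ on the tangent space are negligible (inverse function
  theorem). Dependence of the differentials forces, off $x_1 = 0$, the vanishing of a function that is
  a quadratic form in $y$. Differentiating it twice along a vertical tangent field $w(x)$ shows that,
  outside a null set, its value at $y = w(x)$ vanishes too; that value is a nonzero
  factor times $(x_1^2 + x_2^2)\, x_0^2\, x_3$, and the sets $x_i = 0$ are again null.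
\<close>

section \<open>Negligible level sets in Euclidean space\<close>

text \<open>Near such a point \<open>h\<close> serves as a coordinate: \<open>F\<close> changes
  \<open>x\<close> only along \<open>k\<close> and satisfies \<open>a \<bullet> F x = h x\<close>.
  It is a local diffeomorphism, so the zero set is locally the image of a piece of the hyperplane
  \<open>a \<bullet> y = 0\<close> under a differentiable inverse.\<close>

lemma level_set_negligible:
  fixes h :: "'a::euclidean_space \<Rightarrow> real"
  assumes U: "open U"
    and h: "\<And>x. x \<in> U \<Longrightarrow> (h has_derivative h' x) (at x)"
    and cont: "\<And>i. i \<in> Basis \<Longrightarrow> continuous_on U (\<lambda>x. h' x i)"
  shows "negligible {x \<in> U. h x = 0 \<and> (\<exists>v. h' x v \<noteq> 0)}" (is "negligible ?Z")
proof (subst locally_negligible_alt, rule ballI)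
  fix x0 assume x0: "x0 \<in> ?Z"
  then obtain v where v: "h' x0 v \<noteq> 0" by blast
  interpret h0: bounded_linear "h' x0" using h x0 has_derivative_bounded_linear by blast
  define k where "k = v /\<^sub>R h' x0 v"
  have hk: "h' x0 k = 1" using v by (simp add: k_def h0.scaleR)
  then have "k \<noteq> 0" using h0.zero by auto
  define a where "a = k /\<^sub>R (k \<bullet> k)"
  have ak: "a \<bullet> k = 1" using \<open>k \<noteq> 0\<close> by (simp add: a_def)
  have "a \<noteq> 0" using ak by auto
  define F where "F = (\<lambda>x. x + (h x - a \<bullet> x) *\<^sub>R k)"
  define B where "B = (\<lambda>x. Blinfun (h' x))"
  have B: "blinfun_apply (B x) = h' x" if "x \<in> U" for x
    unfolding B_def using h[OF that] by (simp add: bounded_linear_Blinfun_apply has_derivative_bounded_linear)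
  define F' where "F' = (\<lambda>x. id_blinfun + (blinfun_scaleR_left k o\<^sub>L (B x - blinfun_inner_left a)))"
  \<comment> \<open>The inverse of \<open>F' x0\<close>: both \<open>h' x0\<close> and
    \<open>a\<close> take the value 1 at \<open>k\<close>, so their difference does not change when
    a multiple of \<open>k\<close> is added to its argument.\<close>
  define G where "G = id_blinfun - (blinfun_scaleR_left k o\<^sub>L (B x0 - blinfun_inner_left a))"
  have F': "blinfun_apply (F' x) v = v + (h' x v - a \<bullet> v) *\<^sub>R k" if "x \<in> U" for x v
    by (simp add: F'_def B that blinfun.bilinear_simps inner_commute)
  have dF: "(F has_derivative F' x) (at x)" if "x \<in> U" for x
  proof -
    have "blinfun_apply (F' x) = (\<lambda>v. v + (h' x v - a \<bullet> v) *\<^sub>R k)"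
      using F' that by blast
    then show ?thesis
      unfolding F_def by (auto intro!: derivative_eq_intros h that)
  qed
  have "continuous_on U B"
  proof (rule continuous_on_blinfun_componentwise)
    fix i :: 'a assume "i \<in> Basis"
    then show "continuous_on U (\<lambda>x. blinfun_apply (B x) i)"
      using cont B by (subst continuous_on_cong[OF refl, of _ _ "\<lambda>x. h' x i"]) simp_all
  qed
  then have cF: "continuous_on U F'"
    unfolding F'_def by (intro continuous_intros)
  have GF: "G o\<^sub>L F' x0 = id_blinfun"
  proof (rule blinfun_eqI)
    fix v
    define t where "t = h' x0 v - a \<bullet> v"
    have "h' x0 (v + t *\<^sub>R k) - a \<bullet> (v + t *\<^sub>R k) = t"
      by (simp add: t_def h0.add h0.scaleR hk ak inner_add_right)
    moreover have "G w = w - (h' x0 w - a \<bullet> w) *\<^sub>R k" for w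
      using x0 by (simp add: G_def B blinfun.bilinear_simps inner_commute[of w])
    ultimately show "(G o\<^sub>L F' x0) v = id_blinfun v"
      using x0 F'[of x0 v] by (simp add: t_def[symmetric])
  qed
  obtain U' V g g' where UV: "open U'" "U' \<subseteq> U" "x0 \<in> U'" "homeomorphism U' V F g"
    "\<And>y. y \<in> V \<Longrightarrow> (g has_derivative (g' y)) (at y)"
  proof (rule inverse_function_theorem[OF U dF cF _ GF])
    show "x0 \<in> U" using x0 by blast
  qed (assumption | rule that)+
  have aF: "a \<bullet> F x = h x" for x
    by (simp add: F_def inner_add_right ak)
  have "negligible (g ` (V \<inter> {y. a \<bullet> y = 0}))"
  proof (rule negligible_differentiable_image_negligible)
    show "negligible (V \<inter> {y. a \<bullet> y = 0})"
      using \<open>a \<noteq> 0\<close> by (intro negligible_Int) (auto intro: negligible_hyperplane)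
    show "g differentiable_on V \<inter> {y. a \<bullet> y = 0}"
      unfolding differentiable_on_def differentiable_def using UV(5) has_derivative_at_withinI by blast
  qed simp
  moreover have "?Z \<inter> U' \<subseteq> g ` (V \<inter> {y. a \<bullet> y = 0})"
  proof
    fix x assume "x \<in> ?Z \<inter> U'"
    then have "g (F x) = x" "F x \<in> V \<inter> {y. a \<bullet> y = 0}"
      using UV(4) aF by (auto simp: homeomorphism_def)
    then show "x \<in> g ` (V \<inter> {y. a \<bullet> y = 0})" by (metis imageI)
  qed
  ultimately have "negligible (?Z \<inter> U')" by (rule negligible_subset)
  then show "\<exists>W. openin (top_of_set ?Z) W \<and> x0 \<in> W \<and> negligible W"
    using UV(1,3) x0 by (intro exI[of _ "?Z \<inter> U'"]) (auto simp: openin_open)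
qed

section \<open>Gradients and smoothness of polynomial functions\<close>

text \<open>Induction over the constructors, with the product rule for \<open>mult\<close>. That
  each directional derivative is again polynomial drives the coinduction for
  \<open>smooth_on\<close> and gives the continuity needed in \<open>null_level_set\<close>.\<close>

lemma real_polynomial_function_gradient:
  fixes f :: "'a::euclidean_space \<Rightarrow> real"
  assumes "real_polynomial_function f"
  obtains g where "\<And>p. (f has_derivative (\<lambda>v. g p \<bullet> v)) (at p)"
    "\<And>v. real_polynomial_function (\<lambda>p. g p \<bullet> v)"
proof -
  have "\<exists>g. (\<forall>p. (f has_derivative (\<lambda>v. g p \<bullet> v)) (at p)) \<and>
    (\<forall>v. real_polynomial_function (\<lambda>p. g p \<bullet> v))"
    using assms
  proof induction
    case (linear f)
    \<comment> \<open>The vector representing the linear functional \<open>f\<close> by the inner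
      product.\<close>
    define g where "g = adjoint f 1"
    have "f v = g \<bullet> v" for v
      unfolding g_def using adjoint_works[of f v 1] linear
      by (simp add: bounded_linear.linear inner_commute)
    then have "f = (\<lambda>v. g \<bullet> v)" by (rule ext)
    then have "(f has_derivative (\<lambda>v. g \<bullet> v)) (at p)" for p
      using bounded_linear_imp_has_derivative[OF linear] by simp
    then show ?case
      by (intro exI[of _ "\<lambda>p. g"]) auto
  next
    case (const c)
    show ?case by (rule exI[of _ "\<lambda>p. 0"]) auto
  next
    case (add f g)
    then obtain F G where
      "\<forall>p. (f has_derivative (\<lambda>v. F p \<bullet> v)) (at p)" "\<forall>v. real_polynomial_function (\<lambda>p. F p \<bullet> v)"
      "\<forall>p. (g has_derivative (\<lambda>v. G p \<bullet> v)) (at p)" "\<forall>v. real_polynomial_function (\<lambda>p. G p \<bullet> v)"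
      by blast
    then show ?case
      by (intro exI[of _ "\<lambda>p. F p + G p"])
        (auto simp: inner_add_left intro!: derivative_eq_intros)
  next
    case (mult f g)
    then obtain F G where
      "\<forall>p. (f has_derivative (\<lambda>v. F p \<bullet> v)) (at p)" "\<forall>v. real_polynomial_function (\<lambda>p. F p \<bullet> v)"
      "\<forall>p. (g has_derivative (\<lambda>v. G p \<bullet> v)) (at p)" "\<forall>v. real_polynomial_function (\<lambda>p. G p \<bullet> v)"
      by blast
    then show ?case using mult.hyps
      by (intro exI[of _ "\<lambda>p. f p *\<^sub>R G p + g p *\<^sub>R F p"])
        (auto simp: inner_add_left intro!: derivative_eq_intros real_polynomial_function.intros(3,4))
  qed
  then show ?thesis using that by blast
qed

text \<open>The class of polynomial functions is closed under directional derivatives, so it is a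
  coinduction invariant.\<close>

lemma real_polynomial_function_smooth_on:
  fixes f :: "'a::euclidean_space \<Rightarrow> real"
  assumes "real_polynomial_function f"
  shows "smooth_on S f"
  using assms
proof (coinduction arbitrary: f)
  case smooth_on
  then obtain g where g: "\<And>p. (f has_derivative (\<lambda>v. g p \<bullet> v)) (at p)"
    "\<And>v. real_polynomial_function (\<lambda>p. g p \<bullet> v)"
    using real_polynomial_function_gradient by blast
  then have "frechet_derivative f (at p) v = g p \<bullet> v" for p v
    by (metis frechet_derivative_at)
  then show ?case using g by (auto simp: differentiable_def)
qed

section \<open>Conormal, gradients and tangent space\<close>

text \<open>\<open>sum_4\<close> lists the indices as 1, 2, 3, 4, whereas the definitions write 0
  for the last one.\<close>

lemma four_eq_zero: "(4::4) = 0" by simp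

lemma inner_real4:
  "(u::real^4) \<bullet> v = u $ 0 * v $ 0 + u $ 1 * v $ 1 + u $ 2 * v $ 2 + u $ 3 * v $ 3"
  by (simp add: inner_vec_def sum_4 four_eq_zero)

text \<open>At \<open>x\<close> this is the conormal, half the \<open>x\<close>-gradient of
  \<open>C1\<close> and also the \<open>y\<close>-gradient of \<open>C2\<close>; at \<open>y\<close>
  it is the \<open>x\<close>-gradient of \<open>C2\<close>.\<close>

definition covec :: "(4 \<Rightarrow> real) \<Rightarrow> real^4 \<Rightarrow> real^4" where
  "covec \<alpha> x = (\<chi> i. x $ i / \<alpha> i)"

lemma bounded_linear_covec: "bounded_linear (covec \<alpha>)"
  unfolding linear_conv_bounded_linear[symmetric]
  by (rule linearI) (simp_all add: covec_def vec_eq_iff add_divide_distrib)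

lemma covec_inner_commute: "covec \<alpha> x \<bullet> y = covec \<alpha> y \<bullet> x"
  by (simp add: covec_def inner_vec_def mult.commute)

lemma C1_eq: "C1 \<alpha> = (\<lambda>p. covec \<alpha> (fst p) \<bullet> fst p - 1)"
  by (auto simp: C1_def covec_def inner_vec_def power2_eq_square fun_eq_iff)

lemma C2_eq: "C2 \<alpha> = (\<lambda>p. covec \<alpha> (fst p) \<bullet> snd p)"
  by (auto simp: C2_def covec_def inner_vec_def fun_eq_iff)

lemma phase_space_iff:
  "(x, y) \<in> phase_space \<alpha> \<longleftrightarrow> covec \<alpha> x \<bullet> x = 1 \<and> covec \<alpha> x \<bullet> y = 0"
  by (simp add: phase_space_def C1_eq C2_eq)

text \<open>Records differentiability together with the gradient, split into its horizontal part
  \<open>a\<close> and vertical part \<open>b\<close>, the form in which the bracket consumes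
  it.\<close>

definition has_gradient ::
    "(point \<Rightarrow> real) \<Rightarrow> real^4 \<Rightarrow> real^4 \<Rightarrow> point \<Rightarrow> bool" where
  "has_gradient f a b p \<longleftrightarrow> (f has_derivative (\<lambda>v. a \<bullet> fst v + b \<bullet> snd v)) (at p)"

lemma has_gradient_frechet:
  "has_gradient f a b p \<Longrightarrow> frechet_derivative f (at p) = (\<lambda>v. a \<bullet> fst v + b \<bullet> snd v)"
  unfolding has_gradient_def by (rule frechet_derivative_at[symmetric])

lemma has_gradient_C1: "has_gradient (C1 \<alpha>) (2 *\<^sub>R covec \<alpha> x) 0 (x, y)"
  unfolding has_gradient_def C1_eq
  by (auto intro!: derivative_eq_intros bounded_linear.has_derivative[OF bounded_linear_covec]
      simp: covec_inner_commute[of \<alpha> _ x])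

lemma has_gradient_C2: "has_gradient (C2 \<alpha>) (covec \<alpha> y) (covec \<alpha> x) (x, y)"
  unfolding has_gradient_def C2_eq
  by (auto intro!: derivative_eq_intros bounded_linear.has_derivative[OF bounded_linear_covec]
      simp: covec_inner_commute[of \<alpha> _ y])

lemma has_gradient_coord_x: "has_gradient (coord_x i) (axis i 1) 0 p"
  unfolding has_gradient_def coord_x_def
  by (auto intro!: derivative_eq_intros bounded_linear.has_derivative[OF bounded_linear_vec_nth]
      simp: inner_axis')

lemma has_gradient_coord_y: "has_gradient (coord_y i) 0 (axis i 1) p"
  unfolding has_gradient_def coord_y_def
  by (auto intro!: derivative_eq_intros bounded_linear.has_derivative[OF bounded_linear_vec_nth]
      simp: inner_axis')

lemma tangent_space_iff:
  "v \<in> tangent_space \<alpha> (x, y) \<longleftrightarrow>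
    covec \<alpha> x \<bullet> fst v = 0 \<and> covec \<alpha> y \<bullet> fst v + covec \<alpha> x \<bullet> snd v = 0"
  by (simp add: tangent_space_def has_gradient_frechet[OF has_gradient_C1]
      has_gradient_frechet[OF has_gradient_C2])

lemma subspace_tangent_space: "subspace (tangent_space \<alpha> p)"
  by (cases p) (auto simp: subspace_def tangent_space_iff inner_add_right inner_scaleR_right
      simp flip: distrib_left)

text \<open>The tangent space is the orthogonal complement in an 8-dimensional space of
  \<open>g1\<close> and \<open>g2\<close>, which are multiples of the gradients of \<open>C1\<close>
  and \<open>C2\<close>.\<close>

lemma dim_tangent_space:
  assumes "p \<in> phase_space \<alpha>"
  shows "dim (tangent_space \<alpha> p) = 6"
proof -
  obtain x y where p: "p = (x, y)" by (cases p)
  define g1 g2 :: point where "g1 = (covec \<alpha> x, 0)" and "g2 = (covec \<alpha> y, covec \<alpha> x)"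
  have n: "covec \<alpha> x \<noteq> 0" using assms by (auto simp: p phase_space_iff)
  \<comment> \<open>Multiples of \<open>g1\<close> have second part 0, while that of
    \<open>g2\<close> is the nonzero conormal.\<close>
  have "g2 \<notin> span {g1}" using n by (auto simp: span_singleton g1_def g2_def)
  moreover have "g1 \<noteq> 0" using n by (simp add: g1_def zero_prod_def)
  ultimately have "independent {g2, g1}" "g2 \<noteq> g1"
    using span_base[of g1 "{g1}"] by (auto simp: independent_insert)
  then have "dim {g2, g1} = 2" by (simp add: dim_eq_card_independent)
  have "v \<in> tangent_space \<alpha> p \<longleftrightarrow> (\<forall>g\<in>span {g2, g1}. orthogonal g v)" for v
  proof -
    have "v \<in> tangent_space \<alpha> p \<longleftrightarrow> (\<forall>g\<in>{g2, g1}. orthogonal v g)"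
      by (cases v) (auto simp: p tangent_space_iff orthogonal_def g1_def g2_def inner_commute)
    also have "\<dots> \<longleftrightarrow> (\<forall>g\<in>span {g2, g1}. orthogonal v g)"
      by (meson orthogonal_to_span span_base)
    finally show ?thesis by (simp add: orthogonal_commute)
  qed
  then have "tangent_space \<alpha> p = {v \<in> UNIV. \<forall>g\<in>span {g2, g1}. orthogonal g v}"
    by blast
  then show ?thesis
    using dim_subspace_orthogonal_to_vectors[of "span {g2, g1}" UNIV] \<open>dim {g2, g1} = 2\<close>
    by (simp add: dim_span)
qed

section \<open>The Dirac bracket in terms of gradients\<close>

text \<open>\<open>D\<close> is the squared length of the conormal, so where that is nonzero this is
  the matrix of the orthogonal projection along it.\<close>

lemma tensor_xy_eq:
  "tensor_xy \<alpha> (x, y) i j = (if i = j then 1 else 0)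
    - covec \<alpha> x $ i * covec \<alpha> x $ j / (covec \<alpha> x \<bullet> covec \<alpha> x)"
  by (simp add: tensor_xy_def D_def covec_def inner_vec_def power2_eq_square field_simps)

lemma tensor_yy_eq:
  "tensor_yy \<alpha> (x, y) i j =
    - (covec \<alpha> x $ i * covec \<alpha> y $ j - covec \<alpha> x $ j * covec \<alpha> y $ i) / (covec \<alpha> x \<bullet> covec \<alpha> x)"
  by (simp add: tensor_yy_def D_def covec_def inner_vec_def power2_eq_square
      divide_inverse algebra_simps)

text \<open>Contraction of the tensors with the gradients. Every correction term carries a factor
  \<open>n \<bullet> b\<close> or \<open>n \<bullet> d\<close>, hence disappears when both vertical
  gradients are orthogonal to the conormal.\<close>

lemma dirac_bracket_gradient:
  fixes \<alpha> :: "4 \<Rightarrow> real"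
  assumes f: "has_gradient f a b (x, y)" and g: "has_gradient g c d (x, y)"
  defines "n \<equiv> covec \<alpha> x" and "m \<equiv> covec \<alpha> y"
  shows "dirac_bracket \<alpha> f g (x, y) = a \<bullet> d - b \<bullet> c
    - ((n \<bullet> a) * (n \<bullet> d) - (n \<bullet> b) * (n \<bullet> c) + (n \<bullet> b) * (m \<bullet> d) - (m \<bullet> b) * (n \<bullet> d)) / (n \<bullet> n)"
proof -
  have p: "partial_x i f (x, y) = a $ i" "partial_y i f (x, y) = b $ i"
    "partial_x i g (x, y) = c $ i" "partial_y i g (x, y) = d $ i" for i
    by (simp_all add: partial_x_def partial_y_def inner_axis has_gradient_frechet[OF f]
        has_gradient_frechet[OF g])
  define E where "E = inverse (n \<bullet> n)"
  have prod: "(u \<bullet> v) * (w \<bullet> z) = (\<Sum>i\<in>UNIV. \<Sum>j\<in>UNIV. u $ i * v $ i * (w $ j * z $ j))"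
    for u v w z :: "real^4"
    by (simp add: inner_vec_def sum_product)
  \<comment> \<open>Single inner products also become double sums, by a Kronecker delta, so that the
    identity can be checked summand by summand.\<close>
  have diag: "u \<bullet> v = (\<Sum>i\<in>UNIV. \<Sum>j\<in>UNIV. (if i = j then 1 else 0) * (u $ i * v $ j))"
    for u v :: "real^4"
    by (simp add: inner_vec_def if_distrib[of "\<lambda>t. t * _"] sum.If_cases cong: if_cong)
  have "a \<bullet> d - c \<bullet> b
    - ((n \<bullet> a) * (n \<bullet> d) - (n \<bullet> c) * (n \<bullet> b) + (n \<bullet> b) * (m \<bullet> d) - (m \<bullet> b) * (n \<bullet> d)) * E
    = dirac_bracket \<alpha> f g (x, y)"
    unfolding dirac_bracket_def p tensor_xy_eq tensor_yy_eq divide_inverse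
      n_def[symmetric] m_def[symmetric] E_def[symmetric] prod
    unfolding diag[of a] diag[of c] sum_distrib_right sum.distrib[symmetric] sum_subtractf[symmetric]
    by (intro sum.cong refl) (simp add: algebra_simps)
  then show ?thesis
    by (simp add: divide_inverse E_def inner_commute[of b c] mult.commute)
qed

lemma hamiltonian_vector_field_gradient:
  fixes \<alpha> :: "4 \<Rightarrow> real"
  assumes "has_gradient F c d (x, y)"
  defines "n \<equiv> covec \<alpha> x" and "m \<equiv> covec \<alpha> y"
  shows "hamiltonian_vector_field \<alpha> F (x, y) =
    (d - (n \<bullet> d / (n \<bullet> n)) *\<^sub>R n,
     (n \<bullet> d / (n \<bullet> n)) *\<^sub>R m - c - ((m \<bullet> d - n \<bullet> c) / (n \<bullet> n)) *\<^sub>R n)"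
  unfolding hamiltonian_vector_field_def n_def m_def
  by (auto simp: vec_eq_iff dirac_bracket_gradient[OF has_gradient_coord_x assms(1)]
      dirac_bracket_gradient[OF has_gradient_coord_y assms(1)] inner_axis inner_axis'
      diff_divide_distrib add_divide_distrib algebra_simps)

lemma frechet_derivative_hamiltonian_vector_field:
  assumes f: "has_gradient f a b p" and g: "has_gradient g c d p"
  shows "frechet_derivative f (at p) (hamiltonian_vector_field \<alpha> g p) = dirac_bracket \<alpha> f g p"
proof -
  obtain x y where p: "p = (x, y)" by (cases p)
  show ?thesis
    unfolding has_gradient_frechet[OF f] using f g
    by (simp add: p hamiltonian_vector_field_gradient dirac_bracket_gradient inner_diff_right
        inner_add_right inner_commute[of a "covec \<alpha> _"] inner_commute[of b "covec \<alpha> _"]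
        diff_divide_distrib add_divide_distrib algebra_simps)
qed

text \<open>One inclusion says that \<open>C1\<close> and \<open>C2\<close> are Casimirs; for the
  other, linear functions \<open>F\<close> already produce every tangent vector.\<close>

lemma hamiltonian_vector_fields_span_tangent_space:
  assumes "p \<in> phase_space \<alpha>"
  shows "{hamiltonian_vector_field \<alpha> F p |F. smooth_on UNIV F} = tangent_space \<alpha> p"
proof -
  obtain x y where p: "p = (x, y)" by (cases p)
  define n m where "n = covec \<alpha> x" and "m = covec \<alpha> y"
  have n: "n \<bullet> n \<noteq> 0" using assms by (auto simp: n_def p phase_space_iff)
  show ?thesis
  proof (intro equalityI subsetI)
    fix v assume "v \<in> {hamiltonian_vector_field \<alpha> F p |F. smooth_on UNIV F}"
    then obtain F where F: "v = hamiltonian_vector_field \<alpha> F p" "smooth_on UNIV F" by blast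
    then have "F differentiable (at p)" by (auto elim: smooth_on.cases)
    then obtain f' where f': "(F has_derivative f') (at p)" by (auto simp: differentiable_def)
    then have "linear f'" by (rule has_derivative_linear)
    then have "f' v = adjoint f' 1 \<bullet> v" for v
      using adjoint_works[of f' v 1] by (simp add: inner_commute)
    then have "has_gradient F (fst (adjoint f' 1)) (snd (adjoint f' 1)) p"
      using f' by (metis (no_types, lifting) ext has_gradient_def inner_prod_def)
    then show "v \<in> tangent_space \<alpha> p"
      using n by (simp add: F(1) p hamiltonian_vector_field_gradient tangent_space_iff
          inner_diff_right inner_add_right n_def[symmetric] m_def[symmetric] inner_commute[of m n])
  next
    fix v assume v: "v \<in> tangent_space \<alpha> p"
    \<comment> \<open>The Hamiltonian that generates the constant field \<open>v\<close> for the
      canonical bracket. The two tangency equations of \<open>v\<close> make the Dirac corrections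
      vanish.\<close>
    define F where "F = (\<lambda>q::point. fst v \<bullet> snd q - snd v \<bullet> fst q)"
    have "bounded_linear F"
      unfolding F_def by (intro bounded_linear_intros)
    then have "smooth_on UNIV F"
      by (intro real_polynomial_function_smooth_on real_polynomial_function.intros(1))
    have "has_gradient F (- snd v) (fst v) (x, y)"
      unfolding has_gradient_def F_def by (auto intro!: derivative_eq_intros)
    then have "hamiltonian_vector_field \<alpha> F p = v"
      using v n by (simp add: p hamiltonian_vector_field_gradient tangent_space_iff prod_eq_iff
          n_def[symmetric] m_def[symmetric])
    then show "v \<in> {hamiltonian_vector_field \<alpha> F p |F. smooth_on UNIV F}"
      using \<open>smooth_on UNIV F\<close> by blast
  qed
qed

section \<open>Charts and null sets of the phase space\<close>

text \<open>\<open>C1\<close> and \<open>C2\<close> vanish along the chart, which puts the range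
  inside the tangent space; by injectivity both have dimension 6.\<close>

lemma range_derivative_parametrization:
  assumes \<phi>: "local_parametrization \<alpha> U \<phi>" and u: "u \<in> U"
  shows "range (frechet_derivative \<phi> (at u)) = tangent_space \<alpha> (\<phi> u)"
proof -
  let ?L = "frechet_derivative \<phi> (at u)"
  have "open U" "smooth_on U \<phi>" and inj: "inj ?L" and sub: "\<phi> ` U \<subseteq> phase_space \<alpha>"
    using \<phi> u by (auto simp: local_parametrization_def dest: openin_imp_subset)
  then have L: "(\<phi> has_derivative ?L) (at u)"
    using u by (auto elim!: smooth_on.cases simp: frechet_derivative_works)
  then have lin: "linear ?L" by (rule has_derivative_linear)
  have zero: "frechet_derivative f (at (\<phi> u)) (?L v) = 0"
    if "has_gradient f a b (\<phi> u)" "\<And>p. p \<in> phase_space \<alpha> \<Longrightarrow> f p = 0" for f a b v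
  proof -
    have "((\<lambda>u. f (\<phi> u)) has_derivative (\<lambda>v. frechet_derivative f (at (\<phi> u)) (?L v))) (at u)"
      using that(1) L has_gradient_frechet[OF that(1)]
      by (auto simp: has_gradient_def intro: has_derivative_compose)
    moreover have "((\<lambda>u. f (\<phi> u)) has_derivative (\<lambda>v. 0)) (at u)"
      by (rule has_derivative_transform_within_open[OF has_derivative_const[of 0] \<open>open U\<close> u])
        (metis image_subset_iff sub that(2))
    ultimately show ?thesis
      using has_derivative_unique by (metis (no_types, lifting))
  qed
  obtain x y where xy: "\<phi> u = (x, y)" by (cases "\<phi> u")
  have "range ?L \<subseteq> tangent_space \<alpha> (\<phi> u)"
    using zero[of "C1 \<alpha>", unfolded xy, OF has_gradient_C1]
      zero[of "C2 \<alpha>", unfolded xy, OF has_gradient_C2]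
    by (auto simp: tangent_space_def phase_space_def xy)
  moreover have "dim (range ?L) = dim (tangent_space \<alpha> (\<phi> u))"
    using dim_image_eq[OF lin, of UNIV] inj sub u by (simp add: dim_tangent_space image_subset_iff)
  ultimately show ?thesis
    by (intro subspace_dim_equal linear_subspace_image lin subspace_UNIV subspace_tangent_space) auto
qed

text \<open>Pulled back to a chart, this is \<open>level_set_negligible\<close>: a tangent vector
  not killed by the differential of \<open>h\<close> is the image of a chart vector.\<close>

lemma null_level_set:
  assumes h: "real_polynomial_function h"
  shows "null_in_phase_space \<alpha>
    {p \<in> phase_space \<alpha>. h p = 0 \<and> (\<exists>v\<in>tangent_space \<alpha> p. frechet_derivative h (at p) v \<noteq> 0)}"
  unfolding null_in_phase_space_def
proof (intro allI impI)
  fix U \<phi> assume \<phi>: "local_parametrization \<alpha> U \<phi>"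
  then have "open U" and smooth: "smooth_on U \<phi>" by (auto simp: local_parametrization_def)
  let ?L = "\<lambda>u. frechet_derivative \<phi> (at u)"
  have d\<phi>: "(\<phi> has_derivative ?L u) (at u)" if "u \<in> U" for u
    using smooth that by (auto elim!: smooth_on.cases simp: frechet_derivative_works)
  have "smooth_on U (\<lambda>u. ?L u i)" for i
    using smooth by (auto elim: smooth_on.cases)
  then have cont_L: "continuous_on U (\<lambda>u. ?L u i)" for i
    by (metis (no_types, lifting) continuous_at_imp_continuous_on
        differentiable_imp_continuous_within smooth_on.cases)
  have cont_\<phi>: "continuous_on U \<phi>"
    using d\<phi> by (meson continuous_at_imp_continuous_on has_derivative_continuous)
  obtain g where g: "\<And>p. (h has_derivative (\<lambda>v. g p \<bullet> v)) (at p)"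
    "\<And>v. real_polynomial_function (\<lambda>p. g p \<bullet> v)"
    using real_polynomial_function_gradient[OF h] by blast
  have "continuous_on UNIV g"
    unfolding continuous_on_componentwise[of UNIV g]
    using g(2) by (simp add: continuous_on_polymonial_function real_polynomial_function_eq)
  then have cont_g: "continuous_on U (\<lambda>u. g (\<phi> u))"
    using cont_\<phi> continuous_on_compose2 by blast
  have "negligible {u \<in> U. h (\<phi> u) = 0 \<and> (\<exists>v. g (\<phi> u) \<bullet> ?L u v \<noteq> 0)}"
  proof (rule level_set_negligible[OF \<open>open U\<close>])
    show "((\<lambda>u. h (\<phi> u)) has_derivative (\<lambda>v. g (\<phi> u) \<bullet> ?L u v)) (at u)" if "u \<in> U" for u
      using has_derivative_compose[OF d\<phi>[OF that] g(1)] .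
    show "continuous_on U (\<lambda>u. g (\<phi> u) \<bullet> ?L u i)" for i
      by (intro continuous_intros cont_g cont_L)
  qed
  moreover have "{u \<in> U. \<phi> u \<in> {p \<in> phase_space \<alpha>. h p = 0 \<and>
      (\<exists>v\<in>tangent_space \<alpha> p. frechet_derivative h (at p) v \<noteq> 0)}} \<subseteq>
    {u \<in> U. h (\<phi> u) = 0 \<and> (\<exists>v. g (\<phi> u) \<bullet> ?L u v \<noteq> 0)}"
    using range_derivative_parametrization[OF \<phi>] frechet_derivative_at[OF g(1)]
    by (auto simp: set_eq_iff image_iff) metis
  ultimately show "negligible {u \<in> U. \<phi> u \<in> {p \<in> phase_space \<alpha>. h p = 0 \<and>
      (\<exists>v\<in>tangent_space \<alpha> p. frechet_derivative h (at p) v \<noteq> 0)}}"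
    by (rule negligible_subset)
qed

lemma null_in_phase_space_Un:
  "null_in_phase_space \<alpha> M \<Longrightarrow> null_in_phase_space \<alpha> N \<Longrightarrow> null_in_phase_space \<alpha> (M \<union> N)"
  unfolding null_in_phase_space_def
  by (auto simp: Collect_disj_eq conj_disj_distribL)

lemma null_in_phase_space_subset:
  "null_in_phase_space \<alpha> N \<Longrightarrow> M \<subseteq> N \<Longrightarrow> null_in_phase_space \<alpha> M"
  unfolding null_in_phase_space_def
  by (smt (verit, del_insts) Collect_mono_iff negligible_subset subset_eq)

section \<open>Polynomiality and gradients of the integrals\<close>

lemma real_polynomial_function_coord:
  "real_polynomial_function (\<lambda>p::point. fst p $ i)"
  "real_polynomial_function (\<lambda>p::point. snd p $ i)"
  by (auto intro!: real_polynomial_function.intros(1) bounded_linear_intros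
      bounded_linear_compose[OF bounded_linear_vec_nth])

lemma real_polynomial_function_inner:
  fixes u v :: "point \<Rightarrow> real^4"
  assumes "\<And>i. real_polynomial_function (\<lambda>p. u p $ i)"
    and "\<And>i. real_polynomial_function (\<lambda>p. v p $ i)"
  shows "real_polynomial_function (\<lambda>p. u p \<bullet> v p)"
  unfolding inner_vec_def inner_real_def
  by (intro real_polynomial_function_sum real_polynomial_function.intros(4) assms) auto

lemmas real_polynomial_function_intros =
  real_polynomial_function_coord real_polynomial_function.intros(2-4)
  real_polynomial_function_diff real_polynomial_function_minus real_polynomial_function_power

text \<open>For components of vectors that are defined by cases on the index.\<close>

lemma real_polynomial_function_if:
  "real_polynomial_function f \<Longrightarrow> real_polynomial_function g \<Longrightarrow>
    real_polynomial_function (\<lambda>p. if b then f p else g p)"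
  by (cases b) auto

text \<open>The generator of rotations in the plane of the two equal semi-axes.\<close>

definition rot :: "real^4 \<Rightarrow> real^4" where
  "rot v = (\<chi> i. if i = 1 then - v $ 2 else if i = 2 then v $ 1 else 0)"

text \<open>
  Half of the gradients of $G$ in $x$ and in $y$, with $P = 1/(\alpha_1-\alpha_0)$ and
  $Q = 1/(\alpha_1-\alpha_3)$. The last branch covers the indices 1 and 2.
\<close>

definition third_x :: "real \<Rightarrow> real \<Rightarrow> real^4 \<Rightarrow> real^4 \<Rightarrow> real^4" where
  "third_x P Q x y = (\<chi> i.
    if i = 0 then P * (y$1 * (x$0 * y$1 - x$1 * y$0) + y$2 * (x$0 * y$2 - x$2 * y$0))
    else if i = 3 then - Q * (y$1 * (x$1 * y$3 - x$3 * y$1) + y$2 * (x$2 * y$3 - x$3 * y$2))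
    else Q * y$3 * (x$i * y$3 - x$3 * y$i) - P * y$0 * (x$0 * y$i - x$i * y$0))"

definition third_y :: "real \<Rightarrow> real \<Rightarrow> real^4 \<Rightarrow> real^4 \<Rightarrow> real^4" where
  "third_y P Q x y = (\<chi> i.
    if i = 0 then - P * (x$1 * (x$0 * y$1 - x$1 * y$0) + x$2 * (x$0 * y$2 - x$2 * y$0))
    else if i = 3 then Q * (x$1 * (x$1 * y$3 - x$3 * y$1) + x$2 * (x$2 * y$3 - x$3 * y$2))
    else y$i + P * x$0 * (x$0 * y$i - x$i * y$0) - Q * x$3 * (x$i * y$3 - x$3 * y$i))"

lemma rot_components: "rot v $ 0 = 0" "rot v $ 1 = - v $ 2" "rot v $ 2 = v $ 1" "rot v $ 3 = 0"
  by (simp_all add: rot_def)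

lemma third_x_components:
  "third_x P Q x y $ 0 = P * (y$1 * (x$0 * y$1 - x$1 * y$0) + y$2 * (x$0 * y$2 - x$2 * y$0))"
  "third_x P Q x y $ 1 = Q * y$3 * (x$1 * y$3 - x$3 * y$1) - P * y$0 * (x$0 * y$1 - x$1 * y$0)"
  "third_x P Q x y $ 2 = Q * y$3 * (x$2 * y$3 - x$3 * y$2) - P * y$0 * (x$0 * y$2 - x$2 * y$0)"
  "third_x P Q x y $ 3 = - Q * (y$1 * (x$1 * y$3 - x$3 * y$1) + y$2 * (x$2 * y$3 - x$3 * y$2))"
  by (simp_all add: third_x_def)

lemma third_y_components:
  "third_y P Q x y $ 0 = - P * (x$1 * (x$0 * y$1 - x$1 * y$0) + x$2 * (x$0 * y$2 - x$2 * y$0))"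
  "third_y P Q x y $ 1 = y$1 + P * x$0 * (x$0 * y$1 - x$1 * y$0) - Q * x$3 * (x$1 * y$3 - x$3 * y$1)"
  "third_y P Q x y $ 2 = y$2 + P * x$0 * (x$0 * y$2 - x$2 * y$0) - Q * x$3 * (x$2 * y$3 - x$3 * y$2)"
  "third_y P Q x y $ 3 = Q * (x$1 * (x$1 * y$3 - x$3 * y$1) + x$2 * (x$2 * y$3 - x$3 * y$2))"
  by (simp_all add: third_y_def)

lemma third_y_line: "third_y P Q x (y + t *\<^sub>R w) = third_y P Q x y + t *\<^sub>R third_y P Q x w"
  by (simp add: third_y_def vec_eq_iff algebra_simps)

lemma has_gradient_energy: "has_gradient energy 0 (snd p) p"
  unfolding has_gradient_def energy_def case_prod_unfold
  by (auto intro!: derivative_eq_intros bounded_linear.has_derivative[OF bounded_linear_vec_nth]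
      simp: inner_real4)

lemma has_gradient_angular_momentum:
  "has_gradient angular_momentum (- rot (snd p)) (rot (fst p)) p"
  unfolding has_gradient_def angular_momentum_def case_prod_unfold
  by (auto intro!: derivative_eq_intros bounded_linear.has_derivative[OF bounded_linear_vec_nth]
      simp: inner_real4 rot_components algebra_simps)

text \<open>Division by constants becomes multiplication by coefficients, which the derivative and
  polynomial rules can handle.\<close>

lemma third_integral_eq:
  fixes \<alpha> :: "4 \<Rightarrow> real"
  defines "P \<equiv> 1 / (\<alpha> 1 - \<alpha> 0)" and "Q \<equiv> 1 / (\<alpha> 1 - \<alpha> 3)"
  shows "third_integral \<alpha> = (\<lambda>p. (snd p $ 1)\<^sup>2 + (snd p $ 2)\<^sup>2
    + P * (fst p $ 0 * snd p $ 1 - fst p $ 1 * snd p $ 0)\<^sup>2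
    + P * (fst p $ 0 * snd p $ 2 - fst p $ 2 * snd p $ 0)\<^sup>2
    + Q * (fst p $ 1 * snd p $ 3 - fst p $ 3 * snd p $ 1)\<^sup>2
    + Q * (fst p $ 2 * snd p $ 3 - fst p $ 3 * snd p $ 2)\<^sup>2)"
  by (simp add: third_integral_def P_def Q_def case_prod_unfold)

lemma has_gradient_third_integral:
  fixes \<alpha> :: "4 \<Rightarrow> real"
  defines "P \<equiv> 1 / (\<alpha> 1 - \<alpha> 0)" and "Q \<equiv> 1 / (\<alpha> 1 - \<alpha> 3)"
  shows "has_gradient (third_integral \<alpha>) (2 *\<^sub>R third_x P Q (fst p) (snd p))
    (2 *\<^sub>R third_y P Q (fst p) (snd p)) p"
  unfolding has_gradient_def third_integral_eq P_def[symmetric] Q_def[symmetric]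
  by (rule derivative_eq_intros bounded_linear.has_derivative[OF bounded_linear_vec_nth] refl)+
    (simp add: inner_real4 third_x_components third_y_components fun_eq_iff algebra_simps)

lemma real_polynomial_function_integrals:
  "real_polynomial_function energy" "real_polynomial_function angular_momentum"
  "real_polynomial_function (third_integral \<alpha>)"
  unfolding energy_def angular_momentum_def third_integral_eq case_prod_unfold
  by (intro real_polynomial_function_intros)+

text \<open>
  Off the coordinate hyperplanes, the two probes together with \<open>rot x\<close>, the vertical gradient of $J$,
  span the vertical tangent directions. Being orthogonal to \<open>rot x\<close>, they do not see $J$.
\<close>

definition probe1 :: "(4 \<Rightarrow> real) \<Rightarrow> real^4 \<Rightarrow> real^4" where
  "probe1 \<alpha> x = (\<chi> i. if i = 0 then \<alpha> 0 * x$3 else if i = 3 then - (\<alpha> 3 * x$0) else 0)"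

definition probe2 :: "(4 \<Rightarrow> real) \<Rightarrow> real^4 \<Rightarrow> real^4" where
  "probe2 \<alpha> x = (\<chi> i. if i = 0 then \<alpha> 0 * ((x$1)\<^sup>2 + (x$2)\<^sup>2)
    else if i = 3 then 0 else - (\<alpha> 1 * x$0 * x$i))"

lemma probe1_components: "probe1 \<alpha> x $ 0 = \<alpha> 0 * x$3" "probe1 \<alpha> x $ 1 = 0"
  "probe1 \<alpha> x $ 2 = 0" "probe1 \<alpha> x $ 3 = - (\<alpha> 3 * x$0)"
  by (simp_all add: probe1_def)

lemma probe2_components: "probe2 \<alpha> x $ 0 = \<alpha> 0 * ((x$1)\<^sup>2 + (x$2)\<^sup>2)"
  "probe2 \<alpha> x $ 1 = - (\<alpha> 1 * x$0 * x$1)" "probe2 \<alpha> x $ 2 = - (\<alpha> 1 * x$0 * x$2)"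
  "probe2 \<alpha> x $ 3 = 0"
  by (simp_all add: probe2_def)

text \<open>Reads a directional derivative off an expansion along a line, so that the full gradients
  of \<open>dependence\<close> and \<open>dependence'\<close> are never computed.\<close>

lemma derivative_along_line:
  assumes f: "(f has_derivative f') (at p)"
    and line: "\<And>t. f (p + t *\<^sub>R v) = f p + t * c + t\<^sup>2 * d"
  shows "f' v = (c::real)"
proof -
  have "((\<lambda>t. p + t *\<^sub>R v) has_derivative (\<lambda>t. t *\<^sub>R v)) (at 0)"
    by (auto intro!: derivative_eq_intros)
  then have "((\<lambda>t. f (p + t *\<^sub>R v)) has_derivative (\<lambda>t. f' (t *\<^sub>R v))) (at 0)"
    using f by (auto intro: has_derivative_compose[where g = f])
  moreover have "((\<lambda>t. f (p + t *\<^sub>R v)) has_derivative (\<lambda>t. t * c)) (at 0)"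
    unfolding line by (auto intro!: derivative_eq_intros)
  ultimately have "(\<lambda>t. f' (t *\<^sub>R v)) = (\<lambda>t. t * c)"
    by (rule has_derivative_unique)
  from fun_cong[OF this, of 1] show ?thesis by simp
qed

text \<open>Where \<open>x $ i = 0\<close> the conormal has no \<open>i\<close>-th component, so
  \<open>axis i 1\<close> is tangent to the ellipsoid and lifts to a tangent vector of the phase
  space on which the differential of the coordinate is 1.\<close>

lemma null_coordinate:
  assumes "\<alpha> i \<noteq> 0"
  shows "null_in_phase_space \<alpha> {p \<in> phase_space \<alpha>. fst p $ i = 0}"
proof (rule null_in_phase_space_subset[OF null_level_set])
  show "real_polynomial_function (\<lambda>p::point. fst p $ i)"
    by (rule real_polynomial_function_coord)
  show "{p \<in> phase_space \<alpha>. fst p $ i = 0} \<subseteq> {p \<in> phase_space \<alpha>. fst p $ i = 0 \<and>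
    (\<exists>v\<in>tangent_space \<alpha> p. frechet_derivative (\<lambda>p. fst p $ i) (at p) v \<noteq> 0)}"
  proof clarsimp
    fix x y assume p: "(x, y) \<in> phase_space \<alpha>" "x $ i = 0"
    let ?n = "covec \<alpha> x" and ?m = "covec \<alpha> y"
    \<comment> \<open>The vertical part is the multiple of the conormal that solves the second
      tangency equation.\<close>
    let ?v = "(axis i 1, - (?m $ i / (?n \<bullet> ?n)) *\<^sub>R ?n)"
    have "?n \<noteq> 0" using p by (auto simp: phase_space_iff)
    then have "?v \<in> tangent_space \<alpha> (x, y)"
      using p by (simp add: tangent_space_iff inner_axis covec_def)
    moreover have "frechet_derivative (\<lambda>p. fst p $ i) (at (x, y)) ?v = 1"
      using frechet_derivative_coord_x[of i "(x, y)"] by (simp add: coord_x_def[abs_def] axis_def)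
    ultimately show "\<exists>v\<in>tangent_space \<alpha> (x, y).
        frechet_derivative (\<lambda>p. fst p $ i) (at (x, y)) v \<noteq> 0"
      by force
  qed
qed

text \<open>Along a flow line the derivative of \<open>F\<close> is its bracket with
  \<open>H\<close>, which is 0, and the time domain is connected.\<close>

lemma constant_of_motionI:
  assumes grad: "\<And>p. has_gradient F (a p) (b p) p" "\<And>p. has_gradient H (c p) (d p) p"
    and bracket: "\<And>p. p \<in> phase_space \<alpha> \<Longrightarrow> dirac_bracket \<alpha> F H p = 0"
  shows "constant_of_motion \<alpha> H F"
  unfolding constant_of_motion_def
proof (intro allI impI ballI)
  fix I \<gamma> s t assume fl: "flow_line \<alpha> H I \<gamma>" and st: "s \<in> I" "t \<in> I"
  have "((\<lambda>u. F (\<gamma> u)) has_derivative (\<lambda>h. 0)) (at u)" if "u \<in> I" for u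
  proof -
    let ?X = "hamiltonian_vector_field \<alpha> H (\<gamma> u)"
    have p: "\<gamma> u \<in> phase_space \<alpha>" and \<gamma>: "(\<gamma> has_derivative (\<lambda>h. h *\<^sub>R ?X)) (at u)"
      using fl that by (auto simp: flow_line_def has_vector_derivative_def)
    have F: "(F has_derivative frechet_derivative F (at (\<gamma> u))) (at (\<gamma> u))"
      using grad(1) has_gradient_frechet[OF grad(1)] by (simp add: has_gradient_def)
    have "frechet_derivative F (at (\<gamma> u)) (h *\<^sub>R ?X) = 0" for h
      using frechet_derivative_hamiltonian_vector_field[OF grad(1,2)] bracket[OF p]
        linear_scale[OF has_derivative_linear[OF F]] by simp
    then show ?thesis
      using has_derivative_compose[OF \<gamma> F] by simp
  qed
  moreover have "open I" "connected I" using fl by (simp_all add: flow_line_def)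
  ultimately show "F (\<gamma> s) = F (\<gamma> t)"
    using has_derivative_zero_unique_connected[of I "\<lambda>u. F (\<gamma> u)" s t] st by blast
qed

section \<open>Tangency of the vertical gradients and involution\<close>

lemma covec_inner4:
  "covec \<alpha> x \<bullet> v = x$0 * v$0 / \<alpha> 0 + x$1 * v$1 / \<alpha> 1 + x$2 * v$2 / \<alpha> 2 + x$3 * v$3 / \<alpha> 3"
  by (simp add: inner_real4 covec_def)

lemma covec_inner_rot: "\<alpha> 1 = \<alpha> 2 \<Longrightarrow> covec \<alpha> x \<bullet> rot x = 0"
  by (simp add: covec_inner4 rot_components)

lemma covec_inner_probe1: "\<alpha> 0 \<noteq> 0 \<Longrightarrow> \<alpha> 3 \<noteq> 0 \<Longrightarrow> covec \<alpha> x \<bullet> probe1 \<alpha> x = 0"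
  by (simp add: covec_inner4 probe1_components)

lemma covec_inner_probe2:
  "\<alpha> 0 \<noteq> 0 \<Longrightarrow> \<alpha> 1 \<noteq> 0 \<Longrightarrow> \<alpha> 1 = \<alpha> 2 \<Longrightarrow> covec \<alpha> x \<bullet> probe2 \<alpha> x = 0"
  by (simp add: covec_inner4 probe2_components power2_eq_square field_simps)

text \<open>The denominators in \<open>G\<close> are made for this: \<open>P\<close> and
  \<open>Q\<close> turn differences of the reciprocals of the \<open>\<alpha> i\<close> into
  products, after which the two equations of the phase space give the cancellation.\<close>

lemma covec_inner_third_y:
  assumes \<alpha>: "\<alpha> 0 \<noteq> 0" "\<alpha> 1 \<noteq> 0" "\<alpha> 3 \<noteq> 0" "\<alpha> 1 = \<alpha> 2"
    and PQ: "P * (\<alpha> 1 - \<alpha> 0) = 1" "Q * (\<alpha> 1 - \<alpha> 3) = 1"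
    and xy: "(x, y) \<in> phase_space \<alpha>"
  shows "covec \<alpha> x \<bullet> third_y P Q x y = 0"
proof -
  define A B C where "A = 1 / \<alpha> 0" and "B = 1 / \<alpha> 1" and "C = 1 / \<alpha> 3"
  have P: "P * (A - B) = A * B" and Q: "Q * (C - B) = C * B"
    using \<alpha> PQ by (simp_all add: A_def B_def C_def field_simps)
  have n: "covec \<alpha> x \<bullet> v = A * x$0 * v$0 + B * (x$1 * v$1 + x$2 * v$2) + C * x$3 * v$3" for v
    using \<alpha> by (simp add: covec_inner4 A_def B_def C_def add_divide_distrib)
  have x: "A * (x$0)\<^sup>2 + B * ((x$1)\<^sup>2 + (x$2)\<^sup>2) + C * (x$3)\<^sup>2 = 1"
    and y: "A * x$0 * y$0 + B * (x$1 * y$1 + x$2 * y$2) + C * x$3 * y$3 = 0"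
    using xy by (simp_all add: phase_space_iff n power2_eq_square mult.assoc)
  let ?\<rho> = "x$1 * y$1 + x$2 * y$2" and ?r = "(x$1)\<^sup>2 + (x$2)\<^sup>2"
  have "covec \<alpha> x \<bullet> third_y P Q x y = B * ?\<rho>
    - (P * (A - B)) * (x$0 * (x$0 * ?\<rho> - ?r * y$0)) + (Q * (C - B)) * (x$3 * (?r * y$3 - x$3 * ?\<rho>))"
    unfolding n by (simp add: third_y_components power2_eq_square algebra_simps)
  \<comment> \<open>The equation of \<open>C1\<close> turns the first bracket into
    \<open>B * ?r\<close>, that of \<open>C2\<close> the second into \<open>- (B * ?\<rho>)\<close>;
    the two summands are then opposite.\<close>
  also have "\<dots> = B * (?\<rho> * (1 - A * (x$0)\<^sup>2 - C * (x$3)\<^sup>2) + ?r * (A * x$0 * y$0 + C * x$3 * y$3))"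
    unfolding P Q by (simp add: power2_eq_square algebra_simps)
  also have "1 - A * (x$0)\<^sup>2 - C * (x$3)\<^sup>2 = B * ?r" using x by simp
  also have "A * x$0 * y$0 + C * x$3 * y$3 = - (B * ?\<rho>)" using y by simp
  finally show ?thesis by simp
qed

lemma dirac_bracket_vertical_tangent:
  fixes \<alpha> :: "4 \<Rightarrow> real"
  assumes "has_gradient f a b (x, y)" "has_gradient g c d (x, y)"
    and "covec \<alpha> x \<bullet> b = 0" "covec \<alpha> x \<bullet> d = 0"
  shows "dirac_bracket \<alpha> f g (x, y) = a \<bullet> d - b \<bullet> c"
  using assms by (simp add: dirac_bracket_gradient)

lemma integrals_in_involution:
  assumes \<alpha>: "0 < \<alpha> 0" "\<alpha> 0 < \<alpha> 1" "\<alpha> 1 = \<alpha> 2" "\<alpha> 2 < \<alpha> 3"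
    and F: "F \<in> {energy, angular_momentum, third_integral \<alpha>}"
    and G: "G \<in> {energy, angular_momentum, third_integral \<alpha>}"
    and p: "p \<in> phase_space \<alpha>"
  shows "dirac_bracket \<alpha> F G p = 0"
proof -
  obtain x y where xy: "p = (x, y)" by (cases p)
  define P Q where "P = 1 / (\<alpha> 1 - \<alpha> 0)" and "Q = 1 / (\<alpha> 1 - \<alpha> 3)"
  have PQ: "P * (\<alpha> 1 - \<alpha> 0) = 1" "Q * (\<alpha> 1 - \<alpha> 3) = 1"
    using \<alpha> by (simp_all add: P_def Q_def)
  have n: "covec \<alpha> x \<bullet> y = 0" "covec \<alpha> x \<bullet> rot x = 0" "covec \<alpha> x \<bullet> third_y P Q x y = 0"
    using \<alpha> p PQ by (simp_all add: xy phase_space_iff covec_inner_rot covec_inner_third_y)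
  note grads = has_gradient_energy[of "(x, y)"] has_gradient_angular_momentum[of "(x, y)"]
    has_gradient_third_integral[of \<alpha> "(x, y)", folded P_def Q_def]
  \<comment> \<open>Fixes the first function in three ways; the \<open>OF\<close> instances below
    supply the second, covering all nine pairs.\<close>
  note bracket = grads[THEN dirac_bracket_vertical_tangent]
  \<comment> \<open>Up to nonzero constant factors, the canonical brackets of \<open>H\<close> with
    \<open>G\<close>, of \<open>H\<close> with \<open>J\<close> and of \<open>J\<close> with
    \<open>G\<close>; they vanish identically in \<open>x\<close> and \<open>y\<close>.\<close>
  have "y \<bullet> third_x P Q x y = 0" "y \<bullet> rot y = 0" "rot y \<bullet> third_y P Q x y + rot x \<bullet> third_x P Q x y = 0"
    by (simp_all add: inner_real4 third_x_components third_y_components rot_components algebra_simps)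
  then show ?thesis
    using F G n by (auto simp: xy inner_commute
        bracket[OF grads(1)] bracket[OF grads(2)] bracket[OF grads(3)])
qed

section \<open>Functional independence almost everywhere\<close>

text \<open>
  The determinant of the vertical differentials of $H$ and $G$ on the two probes, and its
  derivative in $y$ along the first probe.
\<close>

definition dependence :: "(4 \<Rightarrow> real) \<Rightarrow> real \<Rightarrow> real \<Rightarrow> point \<Rightarrow> real" where
  "dependence \<alpha> P Q = (\<lambda>(x, y). (y \<bullet> probe1 \<alpha> x) * (third_y P Q x y \<bullet> probe2 \<alpha> x)
    - (y \<bullet> probe2 \<alpha> x) * (third_y P Q x y \<bullet> probe1 \<alpha> x))"

definition dependence' :: "(4 \<Rightarrow> real) \<Rightarrow> real \<Rightarrow> real \<Rightarrow> point \<Rightarrow> real" where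
  "dependence' \<alpha> P Q = (\<lambda>(x, y).
    (probe1 \<alpha> x \<bullet> probe1 \<alpha> x) * (third_y P Q x y \<bullet> probe2 \<alpha> x)
    + (y \<bullet> probe1 \<alpha> x) * (third_y P Q x (probe1 \<alpha> x) \<bullet> probe2 \<alpha> x)
    - (probe1 \<alpha> x \<bullet> probe2 \<alpha> x) * (third_y P Q x y \<bullet> probe1 \<alpha> x)
    - (y \<bullet> probe2 \<alpha> x) * (third_y P Q x (probe1 \<alpha> x) \<bullet> probe1 \<alpha> x))"

lemma real_polynomial_function_dependence:
  "real_polynomial_function (dependence \<alpha> P Q)" "real_polynomial_function (dependence' \<alpha> P Q)"
proof -
  have probes: "real_polynomial_function (\<lambda>p::point. probe1 \<alpha> (fst p) $ i)"
    "real_polynomial_function (\<lambda>p::point. probe2 \<alpha> (fst p) $ i)" for i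
    unfolding probe1_def probe2_def vec_lambda_beta
    by (intro real_polynomial_function_if real_polynomial_function_intros)+
  have third: "real_polynomial_function (\<lambda>p::point. third_y P Q (fst p) (v p) $ i)"
    if "\<And>j. real_polynomial_function (\<lambda>p. v p $ j)" for v i
    unfolding third_y_def vec_lambda_beta
    by (intro real_polynomial_function_if real_polynomial_function_intros that)
  show "real_polynomial_function (dependence \<alpha> P Q)" "real_polynomial_function (dependence' \<alpha> P Q)"
    unfolding dependence_def dependence'_def case_prod_unfold
    by (intro real_polynomial_function_intros real_polynomial_function_inner probes third)+
qed

text \<open>For fixed \<open>x\<close>, \<open>dependence\<close> is a quadratic form in
  \<open>y\<close>; the coefficient of \<open>t\<^sup>2\<close> is thus its value at the direction
  itself.\<close>

lemma dependence_line:
  "dependence \<alpha> P Q ((x, y) + t *\<^sub>R (0, probe1 \<alpha> x)) = dependence \<alpha> P Q (x, y)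
    + t * dependence' \<alpha> P Q (x, y) + t\<^sup>2 * dependence \<alpha> P Q (x, probe1 \<alpha> x)"
  by (simp add: dependence_def dependence'_def third_y_line inner_add_left power2_eq_square
      algebra_simps)

text \<open>The second derivative of a quadratic form is twice its value at the direction. The zero
  term fits the shape of \<open>derivative_along_line\<close>.\<close>

lemma dependence'_line:
  "dependence' \<alpha> P Q ((x, y) + t *\<^sub>R (0, probe1 \<alpha> x)) = dependence' \<alpha> P Q (x, y)
    + t * (2 * dependence \<alpha> P Q (x, probe1 \<alpha> x)) + t\<^sup>2 * 0"
  by (simp add: dependence_def dependence'_def third_y_line inner_add_left power2_eq_square
      algebra_simps)

text \<open>The factorization makes it visible that the value is nonzero when \<open>x $ 0\<close>,
  \<open>x $ 1\<close> and \<open>x $ 3\<close> are and \<open>P\<close> differs from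
  \<open>Q\<close>.\<close>

lemma dependence_probe1:
  assumes PQ: "P * (\<alpha> 1 - \<alpha> 0) = 1" "Q * (\<alpha> 1 - \<alpha> 3) = 1"
  shows "dependence \<alpha> P Q (x, probe1 \<alpha> x) = ((x$1)\<^sup>2 + (x$2)\<^sup>2) * (P - Q) * (x$0)\<^sup>2 * x$3 *
    ((\<alpha> 0)\<^sup>2 * (\<alpha> 3)\<^sup>2 * ((x$1)\<^sup>2 + (x$2)\<^sup>2)
      + (\<alpha> 1)\<^sup>2 * ((\<alpha> 0)\<^sup>2 * (x$3)\<^sup>2 + (\<alpha> 3)\<^sup>2 * (x$0)\<^sup>2))"
proof -
  \<comment> \<open>The difference of the two equations in \<open>PQ\<close>; it lets
    \<open>P - Q\<close> factor out.\<close>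
  have *: "\<alpha> 0 * P - \<alpha> 3 * Q = \<alpha> 1 * (P - Q)" using PQ by (simp add: algebra_simps)
  let ?K = "third_y P Q x (probe1 \<alpha> x)" and ?r = "(x$1)\<^sup>2 + (x$2)\<^sup>2"
  have K: "?K $ 0 = P * ?r * \<alpha> 0 * x$3" "?K $ 3 = - (Q * ?r * \<alpha> 3 * x$0)"
    by (simp_all add: third_y_components probe1_components power2_eq_square algebra_simps)
  have "?K $ 1 = - (x$1 * x$0 * x$3 * (\<alpha> 0 * P - \<alpha> 3 * Q))"
    "?K $ 2 = - (x$2 * x$0 * x$3 * (\<alpha> 0 * P - \<alpha> 3 * Q))"
    by (simp_all add: third_y_components probe1_components algebra_simps)
  note K = K this[unfolded *]
  show ?thesis
    by (simp add: dependence_def inner_real4 K probe1_components probe2_components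
        power2_eq_square algebra_simps)
qed

text \<open>A linear relation is tested on vertical tangent vectors only. On the probes
  \<open>J\<close> drops out, leaving two homogeneous equations for \<open>c 0\<close> and
  \<open>2 * c 2\<close> whose determinant is \<open>dependence\<close>.\<close>

lemma dependence_eq_0:
  assumes \<alpha>: "\<alpha> 0 \<noteq> 0" "\<alpha> 1 \<noteq> 0" "\<alpha> 3 \<noteq> 0" "\<alpha> 1 = \<alpha> 2"
    and "\<not> independent_at \<alpha> [energy, angular_momentum, third_integral \<alpha>] p"
  shows "dependence \<alpha> (1 / (\<alpha> 1 - \<alpha> 0)) (1 / (\<alpha> 1 - \<alpha> 3)) p = 0 \<or> fst p $ 1 = 0"
proof -
  obtain x y where p: "p = (x, y)" by (cases p)
  define P Q where "P = 1 / (\<alpha> 1 - \<alpha> 0)" and "Q = 1 / (\<alpha> 1 - \<alpha> 3)"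
  note grads = has_gradient_frechet[OF has_gradient_energy[of "(x, y)"]]
    has_gradient_frechet[OF has_gradient_angular_momentum[of "(x, y)"]]
    has_gradient_frechet[OF has_gradient_third_integral[of \<alpha> "(x, y)", folded P_def Q_def]]
  obtain c :: "nat \<Rightarrow> real" where c: "\<And>v. v \<in> tangent_space \<alpha> p \<Longrightarrow>
      (\<Sum>k<3. c k * frechet_derivative ([energy, angular_momentum, third_integral \<alpha>] ! k) (at p) v) = 0"
    and nz: "c 0 \<noteq> 0 \<or> c 1 \<noteq> 0 \<or> c 2 \<noteq> 0"
    using assms(5) by (auto simp: independent_at_def numeral_3_eq_3 numeral_2_eq_2 less_Suc_eq)
  have dep: "c 0 * (y \<bullet> w) + c 1 * (rot x \<bullet> w) + 2 * c 2 * (third_y P Q x y \<bullet> w) = 0"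
    if "covec \<alpha> x \<bullet> w = 0" for w
    using c[of "(0, w)"] that
    by (simp add: p tangent_space_iff numeral_3_eq_3 numeral_2_eq_2 grads)
  have "rot x \<bullet> probe1 \<alpha> x = 0" "rot x \<bullet> probe2 \<alpha> x = 0"
    by (simp_all add: inner_real4 rot_components probe1_components probe2_components)
  then have 1: "c 0 * (y \<bullet> probe1 \<alpha> x) + 2 * c 2 * (third_y P Q x y \<bullet> probe1 \<alpha> x) = 0"
    and 2: "c 0 * (y \<bullet> probe2 \<alpha> x) + 2 * c 2 * (third_y P Q x y \<bullet> probe2 \<alpha> x) = 0"
    using dep[of "probe1 \<alpha> x"] dep[of "probe2 \<alpha> x"] \<alpha>
    by (simp_all add: covec_inner_probe1 covec_inner_probe2)
  \<comment> \<open>Cramer's rule.\<close>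
  have "c 0 * dependence \<alpha> P Q p = 0" "c 2 * dependence \<alpha> P Q p = 0"
    unfolding p dependence_def prod.case using 1 2 by algebra+
  \<comment> \<open>Then \<open>c 1\<close> is nonzero, and testing on \<open>rot x\<close> forces
    \<open>rot x = 0\<close>.\<close>
  moreover have "x$1 = 0" if "c 0 = 0" "c 2 = 0"
  proof -
    have "rot x \<bullet> rot x = 0"
      using dep[of "rot x"] that nz \<alpha> by (simp add: covec_inner_rot)
    then show ?thesis using rot_components(3)[of x] by simp
  qed
  ultimately show ?thesis
    unfolding P_def Q_def p by auto
qed

lemma null_dependent:
  assumes \<alpha>: "0 < \<alpha> 0" "\<alpha> 0 < \<alpha> 1" "\<alpha> 1 = \<alpha> 2" "\<alpha> 2 < \<alpha> 3"
  shows "null_in_phase_space \<alpha>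
    {p \<in> phase_space \<alpha>. \<not> independent_at \<alpha> [energy, angular_momentum, third_integral \<alpha>] p}"
proof -
  define P Q where "P = 1 / (\<alpha> 1 - \<alpha> 0)" and "Q = 1 / (\<alpha> 1 - \<alpha> 3)"
  \<comment> \<open>\<open>P\<close> is positive and \<open>Q\<close> is negative.\<close>
  have PQ: "P * (\<alpha> 1 - \<alpha> 0) = 1" "Q * (\<alpha> 1 - \<alpha> 3) = 1" and "P - Q \<noteq> 0"
    using \<alpha> by (simp_all add: P_def Q_def)
  let ?f = "dependence \<alpha> P Q" and ?g = "dependence' \<alpha> P Q"
  let ?Z = "\<lambda>h. {p \<in> phase_space \<alpha>. h p = 0 \<and> (\<exists>v\<in>tangent_space \<alpha> p. frechet_derivative h (at p) v \<noteq> 0)}"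
  let ?X = "\<lambda>i. {p \<in> phase_space \<alpha>. fst p $ i = 0}"
  have "null_in_phase_space \<alpha> (?Z ?f \<union> ?Z ?g \<union> ?X 0 \<union> ?X 1 \<union> ?X 3)"
    using \<alpha> by (intro null_in_phase_space_Un null_level_set null_coordinate
        real_polynomial_function_dependence) auto
  moreover have "p \<in> ?Z ?f \<union> ?Z ?g \<union> ?X 0 \<union> ?X 1 \<union> ?X 3"
    if p: "p \<in> phase_space \<alpha>"
      and "\<not> independent_at \<alpha> [energy, angular_momentum, third_integral \<alpha>] p" for p
  proof (rule ccontr)
    assume neg: "p \<notin> ?Z ?f \<union> ?Z ?g \<union> ?X 0 \<union> ?X 1 \<union> ?X 3"
    obtain x y where xy: "p = (x, y)" by (cases p)
    let ?v = "(0, probe1 \<alpha> x)"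
    have v: "?v \<in> tangent_space \<alpha> p"
      using \<alpha> by (simp add: xy tangent_space_iff covec_inner_probe1)
    have deriv: "frechet_derivative h (at p) ?v = c"
      if "real_polynomial_function h" "\<And>t. h (p + t *\<^sub>R ?v) = h p + t * c + t\<^sup>2 * d" for h c d
      using real_polynomial_function_gradient[OF that(1)] derivative_along_line[OF _ that(2)]
      by (metis frechet_derivative_at)
    have x: "x$0 \<noteq> 0" "x$1 \<noteq> 0" "x$3 \<noteq> 0" using neg p by (auto simp: xy)
    then have "?f p = 0"
      using dependence_eq_0[of \<alpha> p] that \<alpha> by (simp add: xy P_def Q_def)
    then have "?g p = 0"
      \<comment> \<open>Since \<open>p\<close> avoids \<open>?Z ?f\<close>, the differential of
        \<open>?f\<close> kills all tangent vectors; on \<open>?v\<close> its value is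
        \<open>?g p\<close>. The same argument for \<open>?g\<close> then yields twice the value at
        \<open>probe1\<close>.\<close>
      using neg p v deriv[OF real_polynomial_function_dependence(1), unfolded xy, OF dependence_line]
      by (auto simp: xy)
    then have "dependence \<alpha> P Q (x, probe1 \<alpha> x) = 0"
      using neg p v deriv[OF real_polynomial_function_dependence(2), unfolded xy, OF dependence'_line]
      by (auto simp: xy)
    moreover have "0 < (\<alpha> 0)\<^sup>2 * (\<alpha> 3)\<^sup>2 * ((x$1)\<^sup>2 + (x$2)\<^sup>2)
        + (\<alpha> 1)\<^sup>2 * ((\<alpha> 0)\<^sup>2 * (x$3)\<^sup>2 + (\<alpha> 3)\<^sup>2 * (x$0)\<^sup>2)"
      using x \<alpha> by (intro add_pos_nonneg mult_pos_pos) auto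
    moreover have "0 < (x$1)\<^sup>2 + (x$2)\<^sup>2" using x by (intro add_pos_nonneg) auto
    ultimately show False
      using x \<open>P - Q \<noteq> 0\<close> by (simp add: dependence_probe1[OF PQ])
  qed
  ultimately show ?thesis
    by (elim null_in_phase_space_subset) blast
qed

theorem theorem3p1:
  fixes \<alpha> :: "4 \<Rightarrow> real"
  assumes "0 < \<alpha> 0" and "\<alpha> 0 < \<alpha> 1" and "\<alpha> 1 = \<alpha> 2" and "\<alpha> 2 < \<alpha> 3"
  shows "liouville_integrable \<alpha> energy [energy, angular_momentum, third_integral \<alpha>] \<and>
         (\<forall>F\<in>{energy, angular_momentum, third_integral \<alpha>}. constant_of_motion \<alpha> energy F)"
proof
  note involution = integrals_in_involution[OF assms]
  show "liouville_integrable \<alpha> energy [energy, angular_momentum, third_integral \<alpha>]"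
    unfolding liouville_integrable_def
    using involution null_dependent[OF assms]
    by (simp add: hamiltonian_vector_fields_span_tangent_space dim_tangent_space
        real_polynomial_function_smooth_on real_polynomial_function_integrals)
  show "\<forall>F\<in>{energy, angular_momentum, third_integral \<alpha>}. constant_of_motion \<alpha> energy F"
    using constant_of_motionI[OF has_gradient_energy has_gradient_energy involution]
      constant_of_motionI[OF has_gradient_angular_momentum has_gradient_energy involution]
      constant_of_motionI[OF has_gradient_third_integral has_gradient_energy involution]
    by simp
qed

end
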